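(* Let $\alpha\in(0,1]$, let $h\in\mathcal{G}(\alpha)$, and let $\phi\in\mathbb{B}$ be such that $$\frac{h''(z)}{h'(z)}=\alpha\,\frac{\phi(z)}{z\phi(z)-1}\qquad\text{for all } z\in\mathbb{D}.$$ Let $m\geq 1$ be an integer. Then $\phi$ is a finite Blaschke product of degree $m$ if and only if $$h'(z)=\prod_{k=1}^{m+1}(1-\zeta_k z)^{\alpha t_k}\qquad (z\in\mathbb{D})$$ for some distinct points $\zeta_1,\dots,\zeta_{m+1}\in\mathbb{T}$ and real numbers $t_1,\dots,t_{m+1}$ with $0<t_k<1$ and $\sum_{k=1}^{m+1}t_k=1$.
   Context: $\mathbb{D}=\{z\in\mathbb{C}:|z|<1\}$ and $\mathbb{T}=\{z\in\mathbb{C}:|z|=1\}$. For $0<\alpha\le 1$, $\mathcal{G}(\alpha)$ is the family of locally univalent analytic functions $h:\mathbb{D}\to\mathbb{C}$ (so $h'\neq0$ in $\mathbb{D}$) with $h(0)=0$, $h'(0)=1$ and $\operatorname{Re}\left(\frac{zh''(z)}{\alpha h'(z)}\right)<\frac12$ for every $z\in\mathbb{D}$. $\mathbb{B}$ is the set of analytic functions $\omega$ on $\mathbb{D}$ with $|\omega(z)|\le1$ for all $z\in\mathbb{D}$. A finite Blaschke product of degree $m$ is a function $z\mapsto \gamma\prod_{k=1}^m\frac{z-b_k}{1-\overline{b_k}z}$ with $|\gamma|=1$ and $b_k\in\mathbb{D}$. Powers $(1-\zeta z)^{s}$, for $\zeta\in\mathbb{T}$ and $s>0$, are taken with the principal branch,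 equal to $1$ at $z=0$. *)

theory Defs
  imports "HOL-Complex_Analysis.Complex_Analysis"
begin

text \<open>
  Functions on the unit disc are represented by total functions on \<^typ>\<open>complex\<close>; everything
  below only constrains their values on the disc.
\<close>

abbreviation unit_disc :: "complex set" ("\<D>") where
  "\<D> \<equiv> ball 0 1"

abbreviation unit_circle :: "complex set" ("\<T>") where
  "\<T> \<equiv> sphere 0 1"

definition locally_univalent_on :: "(complex \<Rightarrow> complex) \<Rightarrow> complex set \<Rightarrow> bool" where
  "locally_univalent_on h S \<longleftrightarrow>
     (\<forall>z\<in>S. \<exists>U. open U \<and> z \<in> U \<and> U \<subseteq> S \<and> inj_on h U)"

definition class_G :: "real \<Rightarrow> (complex \<Rightarrow> complex) set" where
  "class_G \<alpha> = {h. h holomorphic_on \<D> \<and> locally_univalent_on h \<D> \<and>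
     h 0 = 0 \<and> deriv h 0 = 1 \<and>
     (\<forall>z\<in>\<D>. Re (z * deriv (deriv h) z / (of_real \<alpha> * deriv h z)) < 1 / 2)}"

definition class_B :: "(complex \<Rightarrow> complex) set" where
  "class_B = {\<omega>. \<omega> holomorphic_on \<D> \<and> (\<forall>z\<in>\<D>. norm (\<omega> z) \<le> 1)}"

definition finite_Blaschke_product :: "nat \<Rightarrow> (complex \<Rightarrow> complex) \<Rightarrow> bool" where
  "finite_Blaschke_product m \<phi> \<longleftrightarrow>
     (\<exists>\<gamma> b. norm \<gamma> = 1 \<and> (\<forall>k\<in>{1..m}. b k \<in> \<D>) \<and>
        (\<forall>z\<in>\<D>. \<phi> z = \<gamma> * (\<Prod>k=1..m. (z - b k) / (1 - cnj (b k) * z))))"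

end

theory Submission
  imports Defs "HOL-Computational_Algebra.Fundamental_Theorem_Algebra"
begin

text \<open>
  Comparing logarithmic derivatives, the product formula for \<open>h'\<close> is equivalent to
  \<open>\<phi>(z) / (1 - z \<phi>(z)) = \<Sum>k. t k \<zeta> k / (1 - \<zeta> k z)\<close>.
  If \<open>\<phi>\<close> is a Blaschke product of degree \<open>m\<close>, then \<open>B(z) = z \<phi>(z) = z P(z) / Q(z)\<close> is one of degree
  \<open>m + 1\<close>; the equation \<open>B = 1\<close> has \<open>m + 1\<close> simple roots, all on the unit circle, since there
  \<open>w B'(w) / B(w) > 0\<close>. The roots are the \<open>1 / \<zeta> k\<close>, and Lagrange interpolation of \<open>P\<close> and
  \<open>Q\<close> at them gives the partial fractions with \<open>t k = 1 / (w B'(w)) > 0\<close> at \<open>w = 1 / \<zeta> k\<close>.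
  Conversely, the partial fractions give \<open>\<phi> = R / M\<close>, where \<open>M\<close> is, up to a
  unimodular factor, the reciprocal polynomial of \<open>R\<close> and has no zero in the closed disc, so that
  the zeros of \<open>R\<close> lie in the open disc.
\<close>

section \<open>Logarithmic derivatives and products of principal powers\<close>

text \<open>Logarithmic derivatives \<open>d k\<close> add up over a product. They enter as factors
  of the derivatives, so no quotient occurs.\<close>

lemma has_field_derivative_prod_log:
  fixes f :: "'i \<Rightarrow> 'a::real_normed_field \<Rightarrow> 'a"
  assumes "finite K" "\<And>k. k \<in> K \<Longrightarrow> (f k has_field_derivative f k z * d k) (at z)"
  shows "((\<lambda>z. \<Prod>k\<in>K. f k z) has_field_derivative (\<Prod>k\<in>K. f k z) * (\<Sum>k\<in>K. d k)) (at z)"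
  using assms
proof (induction K rule: finite_induct)
  case (insert k K)
  then have "((\<lambda>z. f k z * (\<Prod>k\<in>K. f k z)) has_field_derivative
      (f k z * d k) * (\<Prod>k\<in>K. f k z) + ((\<Prod>k\<in>K. f k z) * (\<Sum>k\<in>K. d k)) * f k z) (at z)"
    by (intro DERIV_mult) auto
  then show ?case
    using insert.hyps by (simp add: algebra_simps)
qed simp

text \<open>The real part is positive because \<open>norm (\<zeta> * z) < 1\<close>. This keeps the
  base of the powers off the branch cut, and in particular nonzero.\<close>

lemma one_minus_ne_nonpos_Reals:
  fixes \<zeta> z :: complex
  assumes "norm \<zeta> = 1" "norm z < 1"
  shows "1 - \<zeta> * z \<notin> \<real>\<^sub>\<le>\<^sub>0"
proof
  assume "1 - \<zeta> * z \<in> \<real>\<^sub>\<le>\<^sub>0"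
  then have "Re (1 - \<zeta> * z) \<le> 0"
    by (auto simp: complex_nonpos_Reals_iff)
  moreover have "Re (\<zeta> * z) \<le> norm (\<zeta> * z)"
    by (rule complex_Re_le_cmod)
  ultimately show False
    using assms by (simp add: norm_mult)
qed

lemma has_field_derivative_prod_powr:
  fixes \<zeta> s :: "'i \<Rightarrow> complex" and z :: complex
  assumes "finite K" "\<And>k. k \<in> K \<Longrightarrow> norm (\<zeta> k) = 1" "norm z < 1"
  shows "((\<lambda>z. \<Prod>k\<in>K. (1 - \<zeta> k * z) powr s k) has_field_derivative
    (\<Prod>k\<in>K. (1 - \<zeta> k * z) powr s k) * (- (\<Sum>k\<in>K. s k * (\<zeta> k / (1 - \<zeta> k * z))))) (at z)"
  unfolding sum_negf[symmetric]
proof (rule has_field_derivative_prod_log[OF assms(1)])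
  fix k assume k: "k \<in> K"
  have np: "1 - \<zeta> k * z \<notin> \<real>\<^sub>\<le>\<^sub>0"
    using one_minus_ne_nonpos_Reals assms(2)[OF k] assms(3) by blast
  then have nz: "1 - \<zeta> k * z \<noteq> 0"
    by auto
  have "((\<lambda>z. (1 - \<zeta> k * z) powr s k) has_field_derivative
      s k * (1 - \<zeta> k * z) powr (s k - 1) * (- \<zeta> k)) (at z)"
    by (rule DERIV_chain2[where f = "\<lambda>z. z powr s k" and g = "\<lambda>z. 1 - \<zeta> k * z", OF has_field_derivative_powr[OF np]]) (auto intro!: derivative_eq_intros)
  also have "s k * (1 - \<zeta> k * z) powr (s k - 1) * (- \<zeta> k)
      = (1 - \<zeta> k * z) powr s k * (- (s k * (\<zeta> k / (1 - \<zeta> k * z))))"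
    using nz by (simp add: powr_diff)
  finally show "((\<lambda>z. (1 - \<zeta> k * z) powr s k) has_field_derivative
      (1 - \<zeta> k * z) powr s k * (- (s k * (\<zeta> k / (1 - \<zeta> k * z))))) (at z)" .
qed

text \<open>The quotient \<open>f / g\<close> has derivative zero, hence is constant on the convex
  ball, and its value at the centre is 1.\<close>

lemma eq_on_ball_if_log_deriv_eq:
  fixes f g :: "complex \<Rightarrow> complex"
  assumes f: "\<And>z. z \<in> ball a r \<Longrightarrow> (f has_field_derivative f z * l z) (at z)"
    and g: "\<And>z. z \<in> ball a r \<Longrightarrow> (g has_field_derivative g z * l z) (at z)"
    and nz: "\<And>z. z \<in> ball a r \<Longrightarrow> g z \<noteq> 0"
    and "f a = g a" "z \<in> ball a r"
  shows "f z = g z"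
proof -
  have a: "a \<in> ball a r"
    using assms(5) by (auto simp: dist_commute intro: le_less_trans[OF zero_le_dist])
  have "((\<lambda>z. f z / g z) has_field_derivative 0) (at x within ball a r)" if "x \<in> ball a r" for x
    using DERIV_divide[OF f[OF that] g[OF that] nz[OF that]] has_field_derivative_at_within
    by (fastforce simp: mult_ac)
  from has_field_derivative_zero_constant[OF convex_ball this] obtain c
    where c: "\<And>x. x \<in> ball a r \<Longrightarrow> f x / g x = c"
    by blast
  have "f z / g z = 1"
    using c[OF a] c[OF assms(5)] nz[OF a] assms(4) by simp
  then show ?thesis
    using nz[OF assms(5)] by simp
qed

text \<open>An injective holomorphic function on an open set has no critical point. This later
  permits division by \<open>deriv h\<close>.\<close>

lemma locally_univalent_on_deriv_ne_0:
  assumes "h holomorphic_on S" "locally_univalent_on h S" "z \<in> S"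
  shows "deriv h z \<noteq> 0"
proof -
  obtain U where "open U" "z \<in> U" "U \<subseteq> S" "inj_on h U"
    using assms(2,3) unfolding locally_univalent_on_def by blast
  then show ?thesis
    using holomorphic_injective_imp_regular[of h U z] holomorphic_on_subset[OF assms(1)] by blast
qed

text \<open>Both \<open>deriv h\<close> and the product equal 1 at 0 and do not vanish on the disc,
  so they agree iff their logarithmic derivatives do; the common factor \<open>- \<alpha>\<close>
  cancels.\<close>

lemma deriv_eq_prod_powr_iff:
  fixes \<alpha> :: real and t :: "'i \<Rightarrow> real"
  assumes "\<alpha> > 0" and h: "h \<in> class_G \<alpha>"
    and eq: "\<forall>z\<in>\<D>. deriv (deriv h) z / deriv h z = of_real \<alpha> * (\<phi> z / (z * \<phi> z - 1))"
    and K: "finite K" "\<And>k. k \<in> K \<Longrightarrow> norm (\<zeta> k) = 1"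
  shows "(\<forall>z\<in>\<D>. deriv h z = (\<Prod>k\<in>K. (1 - \<zeta> k * z) powr of_real (\<alpha> * t k))) \<longleftrightarrow>
    (\<forall>z\<in>\<D>. \<phi> z / (1 - z * \<phi> z) = (\<Sum>k\<in>K. of_real (t k) * (\<zeta> k / (1 - \<zeta> k * z))))"
    (is "(\<forall>z\<in>\<D>. _ = ?F z) \<longleftrightarrow> (\<forall>z\<in>\<D>. _ = ?S z)")
proof -
  have hol: "h holomorphic_on \<D>" and lu: "locally_univalent_on h \<D>" and h0: "deriv h 0 = 1"
    using h by (auto simp: class_G_def)
  have nz: "deriv h z \<noteq> 0" if "z \<in> \<D>" for z
    using locally_univalent_on_deriv_ne_0[OF hol lu that] .
  have neg: "\<phi> z / (z * \<phi> z - 1) = - (\<phi> z / (1 - z * \<phi> z))" for z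
    by (metis minus_diff_eq minus_divide_right)
  have dh: "(deriv h has_field_derivative
      deriv h z * (- of_real \<alpha> * (\<phi> z / (1 - z * \<phi> z)))) (at z)" if z: "z \<in> \<D>" for z
  proof -
    have "(deriv h has_field_derivative deriv (deriv h) z) (at z)"
      using hol z by (intro holomorphic_derivI[of _ \<D>] holomorphic_deriv) auto
    moreover have "deriv (deriv h) z = deriv h z * (- of_real \<alpha> * (\<phi> z / (1 - z * \<phi> z)))"
    proof -
      have "deriv (deriv h) z = deriv h z * (deriv (deriv h) z / deriv h z)"
        using nz[OF z] by simp
      also have "\<dots> = deriv h z * (of_real \<alpha> * (\<phi> z / (z * \<phi> z - 1)))"
        using eq z by simp
      finally show ?thesis
        by (simp add: neg)
    qed
    ultimately show ?thesis by simp
  qed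
  have dF: "(?F has_field_derivative ?F z * (- of_real \<alpha> * ?S z)) (at z)" if "z \<in> \<D>" for z
  proof -
    have "- (\<Sum>k\<in>K. of_real (\<alpha> * t k) * (\<zeta> k / (1 - \<zeta> k * z))) = - of_real \<alpha> * ?S z"
      by (simp add: sum_distrib_left sum_negf mult.assoc)
    moreover have "norm z < 1"
      using that by simp
    ultimately show ?thesis
      using has_field_derivative_prod_powr[where K = K and \<zeta> = \<zeta> and z = z
          and s = "\<lambda>k. of_real (\<alpha> * t k)", OF K]
      by simp
  qed
  have Fnz: "?F z \<noteq> 0" if "z \<in> \<D>" for z
  proof -
    have "1 - \<zeta> k * z \<noteq> 0" if "k \<in> K" for k
      using one_minus_ne_nonpos_Reals[OF K(2)[OF that], of z] \<open>z \<in> \<D>\<close> by auto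
    then show ?thesis
      using K(1) by simp
  qed
  show ?thesis
  proof
    assume L: "\<forall>z\<in>\<D>. deriv h z = ?F z"
    show "\<forall>z\<in>\<D>. \<phi> z / (1 - z * \<phi> z) = ?S z"
    proof
      fix z assume z: "z \<in> \<D>"
      have "(?F has_field_derivative deriv h z * (- of_real \<alpha> * (\<phi> z / (1 - z * \<phi> z)))) (at z)"
        by (rule has_field_derivative_transform_within_open[OF dh[OF z], of \<D>]) (use L z in auto)
      from DERIV_unique[OF this dF[OF z]]
      have "deriv h z * (- of_real \<alpha> * (\<phi> z / (1 - z * \<phi> z))) = deriv h z * (- of_real \<alpha> * ?S z)"
        using L z by simp
      then have "- of_real \<alpha> * (\<phi> z / (1 - z * \<phi> z)) = - of_real \<alpha> * ?S z"
        unfolding mult_cancel_left using nz[OF z] by blast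
      then show "\<phi> z / (1 - z * \<phi> z) = ?S z"
        unfolding mult_cancel_left using \<open>\<alpha> > 0\<close> by auto
    qed
  next
    assume R: "\<forall>z\<in>\<D>. \<phi> z / (1 - z * \<phi> z) = ?S z"
    show "\<forall>z\<in>\<D>. deriv h z = ?F z"
    proof
      fix z assume "z \<in> \<D>"
      show "deriv h z = ?F z"
      proof (rule eq_on_ball_if_log_deriv_eq[OF _ dF Fnz _ \<open>z \<in> \<D>\<close>])
        show "(deriv h has_field_derivative deriv h z * (- of_real \<alpha> * ?S z)) (at z)" if "z \<in> \<D>" for z
          using dh[OF that] bspec[OF R that] by (simp only:)
      qed (use h0 in simp_all)
    qed
  qed
qed


section \<open>Moduli of Blaschke factors on either side of the unit circle\<close>

text \<open>For \<open>norm b < 1\<close> the right-hand side has the sign of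
  \<open>(norm w)\<^sup>2 - 1\<close>, which decides whether a Blaschke factor has modulus below,
  equal to or above 1.\<close>

lemma norm_moebius_sq_diff:
  fixes b w :: complex
  shows "(norm (w - b))\<^sup>2 - (norm (1 - cnj b * w))\<^sup>2 = ((norm w)\<^sup>2 - 1) * (1 - (norm b)\<^sup>2)"
  unfolding cmod_power2 by (simp add: power2_eq_square algebra_simps)

lemma one_minus_cnj_mult_ne_0:
  fixes b w :: complex
  assumes "norm b < 1" "norm w \<le> 1"
  shows "1 - cnj b * w \<noteq> 0"
proof
  assume "1 - cnj b * w = 0"
  then have "norm (cnj b * w) = 1"
    by simp
  moreover have "norm b * norm w \<le> norm b * 1"
    using assms by (intro mult_left_mono) auto
  ultimately show False
    using assms by (simp add: norm_mult)
qed

section \<open>Interpolation and factorization with factors \<open>1 - \<zeta> k * z\<close>\<close>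

text \<open>Lagrange interpolation at the nodes \<open>1 / \<zeta> k\<close>: both sides have degree
  below \<open>card K\<close> and agree at \<open>card K\<close> points. With the basis in this
  form, division by the full product yields partial fractions.\<close>

lemma prod_linear_interpolation:
  fixes \<zeta> :: "'i \<Rightarrow> 'a::field"
  assumes "finite K" "inj_on \<zeta> K" "\<And>k. k \<in> K \<Longrightarrow> \<zeta> k \<noteq> 0" "degree p < card K"
  shows "poly p z = (\<Sum>k\<in>K. poly p (1 / \<zeta> k) / (\<Prod>j\<in>K-{k}. 1 - \<zeta> j / \<zeta> k) * (\<Prod>j\<in>K-{k}. 1 - \<zeta> j * z))"
proof -
  define L where "L k = (\<Prod>j\<in>K-{k}. [:1, - \<zeta> j:])" for k
  define q where "q = (\<Sum>k\<in>K. smult (poly p (1 / \<zeta> k) / (\<Prod>j\<in>K-{k}. 1 - \<zeta> j / \<zeta> k)) (L k))"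
  have degL: "degree (L k) \<le> card K - 1" if "k \<in> K" for k
  proof -
    have "degree (L k) \<le> sum (degree \<circ> (\<lambda>j. [:1, - \<zeta> j:])) (K - {k})"
      unfolding L_def using assms(1) by (intro degree_prod_sum_le) auto
    also have "\<dots> \<le> (\<Sum>j\<in>K-{k}. 1)"
      by (intro sum_mono) auto
    finally show ?thesis
      using that assms(1) by simp
  qed
  have "degree q \<le> card K - 1"
    unfolding q_def using degL
    by (intro degree_sum_le assms(1)) (meson degree_smult_le order_trans)
  then have degq: "degree q < card K"
    using assms(4) by linarith
  have pL: "poly (L k) x = (\<Prod>j\<in>K-{k}. 1 - \<zeta> j * x)" for k x
    by (simp add: L_def poly_prod mult.commute)
  have "p = q"
  proof (rule poly_eqI_degree[where A = "(\<lambda>k. 1 / \<zeta> k) ` K"])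
    have "inj_on (\<lambda>k. 1 / \<zeta> k) K"
      using assms(2) by (auto simp: inj_on_def)
    then have c: "card ((\<lambda>k. 1 / \<zeta> k) ` K) = card K"
      by (rule card_image)
    show "degree p < card ((\<lambda>k. 1 / \<zeta> k) ` K)" "degree q < card ((\<lambda>k. 1 / \<zeta> k) ` K)"
      using c degq assms(4) by simp_all
    fix x assume "x \<in> (\<lambda>k. 1 / \<zeta> k) ` K"
    then obtain i where i: "i \<in> K" "x = 1 / \<zeta> i"
      by blast
    \<comment> \<open>Each other basis polynomial contains the factor that vanishes at
      \<open>1 / \<zeta> i\<close>.\<close>
    have z0: "poly (L k) x = 0" if "k \<in> K" "k \<noteq> i" for k
      unfolding pL using i assms(1,3) that by (auto intro!: prod_zero bexI[of _ i])
    have ne: "(\<Prod>j\<in>K-{i}. 1 - \<zeta> j / \<zeta> i) \<noteq> 0"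
      using assms(1-3) i(1) by (auto simp: inj_on_def)
    have "poly q x = (\<Sum>k\<in>K. if k = i then poly p (1 / \<zeta> i) else 0)"
      unfolding q_def poly_sum
      using z0 ne i by (intro sum.cong) (auto simp: pL)
    then show "poly p x = poly q x"
      using i assms(1) by simp
  qed
  then have "poly p z = poly q z"
    by simp
  then show ?thesis
    by (simp add: q_def poly_sum pL)
qed

text \<open>Pulling \<open>- e k\<close> out of each factor \<open>z - e k\<close> over the roots
  \<open>e k\<close> turns it into \<open>1 - \<zeta> k * z\<close> with
  \<open>\<zeta> k = 1 / e k\<close>; the normalization at 0 makes the remaining constant 1.\<close>

lemma complex_poly_simple_roots_prod:
  fixes p :: "complex poly"
  assumes "poly p 0 = 1" "rsquarefree p"
  obtains \<zeta> :: "nat \<Rightarrow> complex" where "inj_on \<zeta> {1..degree p}"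
    "\<And>k. k \<in> {1..degree p} \<Longrightarrow> \<zeta> k \<noteq> 0 \<and> poly p (1 / \<zeta> k) = 0"
    "\<And>z. poly p z = (\<Prod>k=1..degree p. 1 - \<zeta> k * z)"
proof -
  define W where "W = {w. poly p w = 0}"
  have "p \<noteq> 0"
    using assms(1) by auto
  then have fin: "finite W"
    unfolding W_def by (rule poly_roots_finite)
  have dec: "smult (lead_coeff p) (\<Prod>w\<in>W. [:- w, 1:]) = p"
    unfolding W_def by (rule complex_poly_decompose_rsquarefree[OF assms(2)])
  have lc: "lead_coeff p \<noteq> 0"
    using \<open>p \<noteq> 0\<close> by simp
  have "degree p = degree (\<Prod>w\<in>W. [:- w, 1:])"
    by (subst dec[symmetric]) (use lc in simp)
  also have "\<dots> = card W"
    by (subst degree_prod_sum_eq) auto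
  finally have card: "card W = degree p"
    by simp
  obtain e where e: "bij_betw e {1..degree p} W"
    using ex_bij_betw_nat_finite_1[OF fin] card by auto
  have We: "poly p (e k) = 0" "e k \<noteq> 0" if "k \<in> {1..degree p}" for k
  proof -
    show "poly p (e k) = 0"
      using bij_betwE[OF e] that by (auto simp: W_def)
    then show "e k \<noteq> 0"
      using assms(1) by auto
  qed
  have pe: "poly p z = lead_coeff p * (\<Prod>k=1..degree p. z - e k)" for z
  proof -
    have "poly p z = lead_coeff p * (\<Prod>w\<in>W. z - w)"
      by (subst dec[symmetric]) (simp add: poly_prod)
    then show ?thesis
      using prod.reindex_bij_betw[OF e, of "\<lambda>w. z - w"] by simp
  qed
  show thesis
  proof (rule that[of "\<lambda>k. 1 / e k"])
    show "inj_on (\<lambda>k. 1 / e k) {1..degree p}"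
    proof (rule inj_onI)
      fix i j assume "i \<in> {1..degree p}" "j \<in> {1..degree p}" "1 / e i = 1 / e j"
      then show "i = j"
        using inj_onD[OF bij_betw_imp_inj_on[OF e], of i j] by simp
    qed
    show "1 / e k \<noteq> 0 \<and> poly p (1 / (1 / e k)) = 0" if "k \<in> {1..degree p}" for k
      using We[OF that] by simp
    fix z
    have "(\<Prod>k=1..degree p. z - e k) = (\<Prod>k=1..degree p. (- e k) * (1 - 1 / e k * z))"
      using We by (intro prod.cong) (auto simp: field_simps)
    also have "\<dots> = (\<Prod>k=1..degree p. - e k) * (\<Prod>k=1..degree p. 1 - 1 / e k * z)"
      by (rule prod.distrib)
    finally have "poly p z = (lead_coeff p * (\<Prod>k=1..degree p. - e k)) * (\<Prod>k=1..degree p. 1 - 1 / e k * z)"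
      by (simp add: pe)
    also have "lead_coeff p * (\<Prod>k=1..degree p. - e k) = 1"
      using pe[of 0] assms(1) by simp
    finally show "poly p z = (\<Prod>k=1..degree p. 1 - 1 / e k * z)"
      by simp
  qed
qed

section \<open>Solutions of B = 1 for a Blaschke product B with an extra factor z\<close>

context
  fixes J :: "'i set" and b :: "'i \<Rightarrow> complex" and \<gamma> :: complex
  assumes fin: "finite J" and b: "\<And>j. j \<in> J \<Longrightarrow> norm (b j) < 1" and \<gamma>: "norm \<gamma> = 1"
begin

text \<open>The hypothesis is B(w) = 1 with denominators cleared. Blaschke factors have modulus at
  most 1 inside the circle and at least 1 outside; the extra factor \<open>w\<close> makes the
  comparison strict in both cases, which leaves only the circle.\<close>

lemma Blaschke_fixed_circle:
  assumes eq: "w * (\<gamma> * (\<Prod>j\<in>J. w - b j)) = (\<Prod>j\<in>J. 1 - cnj (b j) * w)"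
  shows "norm w = 1"
proof -
  have n: "norm w * (\<Prod>j\<in>J. norm (w - b j)) = (\<Prod>j\<in>J. norm (1 - cnj (b j) * w))"
    using arg_cong[OF eq, of norm] \<gamma> by (simp add: norm_mult prod_norm)
  have b2: "(norm (b j))\<^sup>2 < 1" if "j \<in> J" for j
    using b[OF that] by (simp add: power_less_one_iff)
  consider "norm w < 1" | "norm w = 1" | "norm w > 1"
    by linarith
  then show ?thesis
  proof cases
    case 1
    have "norm (w - b j) \<le> norm (1 - cnj (b j) * w)" if "j \<in> J" for j
    proof -
      have "((norm w)\<^sup>2 - 1) * (1 - (norm (b j))\<^sup>2) \<le> 0"
        using 1 b2[OF that] by (intro mult_nonpos_nonneg) (auto simp: power_le_one)
      then show ?thesis
        using norm_moebius_sq_diff[of w "b j"] by (intro power2_le_imp_le[OF _ norm_ge_zero]) linarith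
    qed
    then have le: "(\<Prod>j\<in>J. norm (w - b j)) \<le> (\<Prod>j\<in>J. norm (1 - cnj (b j) * w))"
      by (intro prod_mono) auto
    have pos: "(\<Prod>j\<in>J. norm (1 - cnj (b j) * w)) > 0"
      using one_minus_cnj_mult_ne_0[OF b, of _ w] 1 by (intro prod_pos) auto
    have "norm w * (\<Prod>j\<in>J. norm (w - b j)) \<le> norm w * (\<Prod>j\<in>J. norm (1 - cnj (b j) * w))"
      using le by (intro mult_left_mono) auto
    also have "\<dots> < 1 * (\<Prod>j\<in>J. norm (1 - cnj (b j) * w))"
      using 1 pos by (intro mult_strict_right_mono) auto
    finally show ?thesis
      using n by simp
  next
    case 3
    have "norm (1 - cnj (b j) * w) \<le> norm (w - b j)" if "j \<in> J" for j
    proof -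
      have "((norm w)\<^sup>2 - 1) * (1 - (norm (b j))\<^sup>2) \<ge> 0"
        using 3 b2[OF that] by (intro mult_nonneg_nonneg) (auto simp: one_le_power)
      then show ?thesis
        using norm_moebius_sq_diff[of w "b j"] by (intro power2_le_imp_le[OF _ norm_ge_zero]) linarith
    qed
    then have le: "(\<Prod>j\<in>J. norm (1 - cnj (b j) * w)) \<le> (\<Prod>j\<in>J. norm (w - b j))"
      by (intro prod_mono) auto
    have pos: "(\<Prod>j\<in>J. norm (w - b j)) > 0"
      using b 3 by (intro prod_pos) fastforce
    have "1 * (\<Prod>j\<in>J. norm (w - b j)) < norm w * (\<Prod>j\<in>J. norm (w - b j))"
      using 3 pos by (intro mult_strict_right_mono) auto
    then show ?thesis
      using n le by simp
  qed simp
qed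

text \<open>With \<open>B(z) = z \<gamma> (\<Prod>j. (z - b j) / (1 - cnj (b j) z))\<close>, the real factor is
  \<open>w B'(w) / B(w)\<close>.\<close>

lemma Blaschke_fixed_deriv:
  assumes eq: "w * (\<gamma> * (\<Prod>j\<in>J. w - b j)) = (\<Prod>j\<in>J. 1 - cnj (b j) * w)"
    and D: "((\<lambda>z. (\<Prod>j\<in>J. 1 - cnj (b j) * z) - z * (\<gamma> * (\<Prod>j\<in>J. z - b j)))
      has_field_derivative D) (at w)"
  shows "w * D = - (\<Prod>j\<in>J. 1 - cnj (b j) * w)
    * of_real (1 + (\<Sum>j\<in>J. (1 - (norm (b j))\<^sup>2) / (norm (w - b j))\<^sup>2))"
proof -
  let ?Q = "\<Prod>j\<in>J. 1 - cnj (b j) * w" and ?P = "\<Prod>j\<in>J. w - b j"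
  have w: "norm w = 1"
    by (rule Blaschke_fixed_circle[OF eq])
  have nb: "w - b j \<noteq> 0" if "j \<in> J" for j
    using b[OF that] w by auto
  have nq: "1 - cnj (b j) * w \<noteq> 0" if "j \<in> J" for j
    using one_minus_cnj_mult_ne_0[OF b[OF that]] w by simp
  have dQ: "((\<lambda>z. \<Prod>j\<in>J. 1 - cnj (b j) * z) has_field_derivative
      ?Q * (\<Sum>j\<in>J. - cnj (b j) / (1 - cnj (b j) * w))) (at w)"
    using nq by (intro has_field_derivative_prod_log[OF fin]) (auto intro!: derivative_eq_intros)
  have dP: "((\<lambda>z. \<Prod>j\<in>J. z - b j) has_field_derivative ?P * (\<Sum>j\<in>J. 1 / (w - b j))) (at w)"
    using nb by (intro has_field_derivative_prod_log[OF fin]) (auto intro!: derivative_eq_intros)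
  have "((\<lambda>z. (\<Prod>j\<in>J. 1 - cnj (b j) * z) - z * (\<gamma> * (\<Prod>j\<in>J. z - b j)))
      has_field_derivative ?Q * (\<Sum>j\<in>J. - cnj (b j) / (1 - cnj (b j) * w))
        - (1 * (\<gamma> * ?P) + (\<gamma> * (?P * (\<Sum>j\<in>J. 1 / (w - b j)))) * w)) (at w)"
    by (intro DERIV_diff DERIV_mult DERIV_cmult DERIV_ident dQ dP)
  then have "D = ?Q * (\<Sum>j\<in>J. - cnj (b j) / (1 - cnj (b j) * w))
        - (1 * (\<gamma> * ?P) + (\<gamma> * (?P * (\<Sum>j\<in>J. 1 / (w - b j)))) * w)"
    using D DERIV_unique by blast
  then have "w * D = w * (?Q * (\<Sum>j\<in>J. - cnj (b j) / (1 - cnj (b j) * w))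
        - (1 * (\<gamma> * ?P) + (\<gamma> * (?P * (\<Sum>j\<in>J. 1 / (w - b j)))) * w))"
    by simp
  also have "\<dots> = ?Q * (\<Sum>j\<in>J. w * (- cnj (b j) / (1 - cnj (b j) * w)))
        - ((w * (\<gamma> * ?P)) + (w * (\<gamma> * ?P)) * (\<Sum>j\<in>J. w * (1 / (w - b j))))"
    unfolding sum_distrib_left[symmetric] by (simp add: algebra_simps)
  \<comment> \<open>The equation \<open>eq\<close> replaces \<open>w * (\<gamma> * ?P)\<close> by
    \<open>?Q\<close>, which then factors out.\<close>
  also have "\<dots> = ?Q * ((\<Sum>j\<in>J. w * (- cnj (b j) / (1 - cnj (b j) * w)))
        - (1 + (\<Sum>j\<in>J. w * (1 / (w - b j)))))"
    unfolding eq by (simp add: algebra_simps)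
  also have "\<dots> = - ?Q * (1 + ((\<Sum>j\<in>J. w * (1 / (w - b j)))
        - (\<Sum>j\<in>J. w * (- cnj (b j) / (1 - cnj (b j) * w)))))"
    by (simp add: algebra_simps)
  also have "(\<Sum>j\<in>J. w * (1 / (w - b j))) - (\<Sum>j\<in>J. w * (- cnj (b j) / (1 - cnj (b j) * w)))
      = (\<Sum>j\<in>J. of_real ((1 - (norm (b j))\<^sup>2) / (norm (w - b j))\<^sup>2))"
    unfolding sum_subtractf[symmetric]
  proof (rule sum.cong)
    fix j assume j: "j \<in> J"
    have ww: "w * cnj w = 1"
      using w by (simp add: complex_norm_square[symmetric])
    \<comment> \<open>On the circle \<open>cnj w\<close> is the inverse of \<open>w\<close>, so both
      fractions fit over the real denominator \<open>(norm (w - b j))\<^sup>2\<close>.\<close>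
    have q: "1 - cnj (b j) * w = w * cnj (w - b j)"
      using ww by (simp add: algebra_simps)
    have w0: "w \<noteq> 0"
      using w by auto
    have c0: "cnj (w - b j) \<noteq> 0"
      using nb[OF j] by (metis complex_cnj_zero_iff)
    have "w * (1 / (w - b j)) - w * (- cnj (b j) / (1 - cnj (b j) * w))
        = (w * cnj (w - b j) + cnj (b j) * (w - b j)) / ((w - b j) * cnj (w - b j))"
      unfolding q using nb[OF j] w0 c0 by (simp add: divide_simps del: complex_cnj_diff)
    also have "w * cnj (w - b j) + cnj (b j) * (w - b j) = of_real (1 - (norm (b j))\<^sup>2)"
      using ww unfolding of_real_diff complex_norm_square by (simp add: algebra_simps)
    also have "(w - b j) * cnj (w - b j) = of_real ((norm (w - b j))\<^sup>2)"
      by (simp only: complex_norm_square)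
    finally show "w * (1 / (w - b j)) - w * (- cnj (b j) / (1 - cnj (b j) * w))
        = of_real ((1 - (norm (b j))\<^sup>2) / (norm (w - b j))\<^sup>2)"
      by simp
  qed simp
  finally show ?thesis
    by simp
qed

end


section \<open>From a Blaschke product to partial fractions\<close>

lemma prod_div_prod_except:
  fixes f :: "'i \<Rightarrow> 'a::field"
  assumes "finite K" "k \<in> K" "\<And>j. j \<in> K \<Longrightarrow> f j \<noteq> 0"
  shows "(\<Prod>j\<in>K-{k}. f j) / (\<Prod>j\<in>K. f j) = 1 / f k"
  using assms by (simp add: prod.remove[of K k f])

lemma finite_Blaschke_product_imp_partial_fractions:
  assumes "finite_Blaschke_product m \<phi>"
  obtains \<zeta> :: "nat \<Rightarrow> complex" and t :: "nat \<Rightarrow> real" where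
    "\<And>k. k \<in> {1..Suc m} \<Longrightarrow> norm (\<zeta> k) = 1" "inj_on \<zeta> {1..Suc m}"
    "\<And>k. k \<in> {1..Suc m} \<Longrightarrow> 0 < t k" "(\<Sum>k=1..Suc m. t k) = 1"
    "\<And>z. z \<in> \<D> \<Longrightarrow> \<phi> z / (1 - z * \<phi> z) = (\<Sum>k=1..Suc m. of_real (t k) * (\<zeta> k / (1 - \<zeta> k * z)))"
proof -
  obtain \<gamma> b where \<gamma>: "norm \<gamma> = 1" and "\<forall>k\<in>{1..m}. b k \<in> \<D>"
    and "\<forall>z\<in>\<D>. \<phi> z = \<gamma> * (\<Prod>k=1..m. (z - b k) / (1 - cnj (b k) * z))"
    using assms unfolding finite_Blaschke_product_def by blast
  then have b: "\<And>k. k \<in> {1..m} \<Longrightarrow> norm (b k) < 1"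
    and \<phi>: "\<And>z. z \<in> \<D> \<Longrightarrow> \<phi> z = \<gamma> * (\<Prod>k=1..m. (z - b k) / (1 - cnj (b k) * z))"
    by simp_all
  define Q where "Q = (\<Prod>k=1..m. [:1, - cnj (b k):])"
  define P where "P = smult \<gamma> (\<Prod>k=1..m. [:- b k, 1:])"
  \<comment> \<open>\<open>D = 0\<close> is the equation B = 1 with denominators cleared.\<close>
  define D where "D = Q - pCons 0 P"
  have pQ: "poly Q z = (\<Prod>k=1..m. 1 - cnj (b k) * z)" for z
    by (simp add: Q_def poly_prod mult.commute)
  have pP: "poly P z = \<gamma> * (\<Prod>k=1..m. z - b k)" for z
    by (simp add: P_def poly_prod)
  have pD: "poly D z = (\<Prod>k=1..m. 1 - cnj (b k) * z) - z * (\<gamma> * (\<Prod>k=1..m. z - b k))" for z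
    by (simp add: D_def pP pQ)
  have \<gamma>0: "\<gamma> \<noteq> 0"
    using \<gamma> by auto
  have degP: "degree P = m"
    using \<gamma>0 by (simp add: P_def degree_prod_sum_eq)
  have P0: "P \<noteq> 0"
    using \<gamma>0 by (simp add: P_def)
  have "degree Q \<le> sum (degree \<circ> (\<lambda>k. [:1, - cnj (b k):])) {1..m}"
    unfolding Q_def by (intro degree_prod_sum_le) auto
  also have "\<dots> \<le> (\<Sum>k=1..m. 1)"
    by (intro sum_mono) auto
  finally have degQ: "degree Q \<le> m"
    by simp
  \<comment> \<open>The term \<open>pCons 0 P\<close> has degree \<open>m + 1\<close> and dominates
    \<open>Q\<close>; once the roots are known to be simple, there are exactly \<open>m + 1\<close>
    of them.\<close>
  have degD: "degree D = Suc m"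
    using degQ P0 degP unfolding D_def diff_conv_add_uminus
    by (subst degree_add_eq_right) auto
  \<comment> \<open>At a root \<open>w\<close> of \<open>D\<close> this is w B'(w) / B(w), the real
    factor from \<open>Blaschke_fixed_deriv\<close>.\<close>
  define s where "s w = 1 + (\<Sum>k=1..m. (1 - (norm (b k))\<^sup>2) / (norm (w - b k))\<^sup>2)" for w
  have spos: "s w > 0" for w
  proof -
    have "(norm (b k))\<^sup>2 \<le> 1" if "k \<in> {1..m}" for k
      using b[OF that] by (simp add: power_le_one)
    then have "(\<Sum>k=1..m. (1 - (norm (b k))\<^sup>2) / (norm (w - b k))\<^sup>2) \<ge> 0"
      by (intro sum_nonneg divide_nonneg_nonneg) auto
    then show ?thesis
      by (simp add: s_def)
  qed
  have root: "norm w = 1" "w * poly (pderiv D) w = - poly Q w * of_real (s w)"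
    if "poly D w = 0" for w
  proof -
    have eq: "w * (\<gamma> * (\<Prod>k=1..m. w - b k)) = (\<Prod>k=1..m. 1 - cnj (b k) * w)"
      using that by (simp add: pD)
    show "norm w = 1"
      using Blaschke_fixed_circle[OF _ b \<gamma> eq] by blast
    show "w * poly (pderiv D) w = - poly Q w * of_real (s w)"
      using Blaschke_fixed_deriv[OF _ b \<gamma> eq, of "poly (pderiv D) w"] poly_DERIV[of D w]
      unfolding pQ s_def pD by blast
  qed
  have Q0: "poly Q w \<noteq> 0" if "norm w \<le> 1" for w
    unfolding pQ using one_minus_cnj_mult_ne_0[OF b that] by simp
  \<comment> \<open>A multiple root would force \<open>poly Q w * s w = 0\<close> on the circle,
    where \<open>Q\<close> has no zero and \<open>s\<close> is positive.\<close>
  have "rsquarefree D"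
    unfolding rsquarefree_roots
  proof (intro allI notI, elim conjE)
    fix w assume w: "poly D w = 0" "poly (pderiv D) w = 0"
    then show False
      using root[OF w(1)] Q0[of w] spos[of w] by auto
  qed
  moreover have "poly D 0 = 1"
    by (simp add: pD)
  ultimately obtain \<zeta> where inj: "inj_on \<zeta> {1..Suc m}"
    and \<zeta>: "\<And>k. k \<in> {1..Suc m} \<Longrightarrow> \<zeta> k \<noteq> 0 \<and> poly D (1 / \<zeta> k) = 0"
    and Dprod: "\<And>z. poly D z = (\<Prod>k=1..Suc m. 1 - \<zeta> k * z)"
    using complex_poly_simple_roots_prod[of D] unfolding degD by blast
  define t where "t k = 1 / s (1 / \<zeta> k)" for k
  have norm\<zeta>: "norm (\<zeta> k) = 1" if "k \<in> {1..Suc m}" for k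
    using root(1)[of "1 / \<zeta> k"] \<zeta>[OF that] by (simp add: norm_divide)
  \<comment> \<open>Differentiating \<open>D = (1 - \<zeta> k * z) * E\<close> at
    \<open>w = 1 / \<zeta> k\<close> gives \<open>w * D' = - E\<close>. Comparison with
    \<open>w * D' = - Q * s\<close> shows \<open>Q / E = 1 / s\<close>.\<close>
  have residue: "poly Q (1 / \<zeta> k) / (\<Prod>j\<in>{1..Suc m}-{k}. 1 - \<zeta> j / \<zeta> k) = of_real (t k)"
    if k: "k \<in> {1..Suc m}" for k
  proof -
    define w where "w = 1 / \<zeta> k"
    define E where "E = (\<Prod>j\<in>{1..Suc m}-{k}. [:1, - \<zeta> j:])"
    have w: "\<zeta> k * w = 1" "poly D w = 0"
      using \<zeta>[OF k] by (simp_all add: w_def)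
    have pE: "poly E z = (\<Prod>j\<in>{1..Suc m}-{k}. 1 - \<zeta> j * z)" for z
      by (simp add: E_def poly_prod mult.commute)
    have "poly D z = poly ([:1, - \<zeta> k:] * E) z" for z
      using k unfolding Dprod poly_mult pE
      by (subst prod.remove[of _ k]) (auto simp: mult.commute)
    then have "D = [:1, - \<zeta> k:] * E"
      by (simp add: poly_eq_poly_eq_iff[symmetric] fun_eq_iff)
    then have "poly (pderiv D) w
        = poly [:1, - \<zeta> k:] w * poly (pderiv E) w + poly E w * poly (pderiv [:1, - \<zeta> k:]) w"
      by (simp only: pderiv_mult poly_add poly_mult)
    then have "poly (pderiv D) w = - \<zeta> k * poly E w"
      using w(1) by (simp add: pderiv_pCons mult.commute)
    then have "w * poly (pderiv D) w = - poly E w"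
      using w(1) by (simp add: mult.assoc[symmetric] mult.commute[of w])
    then have "poly E w = poly Q w * of_real (s w)"
      using root(2)[OF w(2)] by simp
    moreover have "poly Q w \<noteq> 0"
      using Q0[of w] root(1)[OF w(2)] by simp
    ultimately have "poly Q w / poly E w = of_real (t k)"
      using spos[of w] by (simp add: t_def w_def)
    then show ?thesis
      by (simp add: pE w_def)
  qed
  have Qsum: "poly Q z = (\<Sum>k=1..Suc m. of_real (t k) * (\<Prod>j\<in>{1..Suc m}-{k}. 1 - \<zeta> j * z))" for z
  proof -
    have "degree Q < card {1..Suc m}"
      using degQ by simp
    then have "poly Q z = (\<Sum>k=1..Suc m. poly Q (1 / \<zeta> k) / (\<Prod>j\<in>{1..Suc m}-{k}. 1 - \<zeta> j / \<zeta> k)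
        * (\<Prod>j\<in>{1..Suc m}-{k}. 1 - \<zeta> j * z))"
      using prod_linear_interpolation[OF _ inj, of Q z] \<zeta> by blast
    also have "\<dots> = (\<Sum>k=1..Suc m. of_real (t k) * (\<Prod>j\<in>{1..Suc m}-{k}. 1 - \<zeta> j * z))"
      using residue by (intro sum.cong refl arg_cong2[of _ _ _ _ "(*)"])
    finally show ?thesis .
  qed
  have Psum: "poly P z = (\<Sum>k=1..Suc m. \<zeta> k * of_real (t k) * (\<Prod>j\<in>{1..Suc m}-{k}. 1 - \<zeta> j * z))" for z
  proof -
    \<comment> \<open>At a root of \<open>D\<close> the terms \<open>Q\<close> and
      \<open>z * P\<close> coincide, so the interpolation coefficients of \<open>P\<close> are those
      of \<open>Q\<close> times \<open>\<zeta> k\<close>.\<close>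
    have "poly P (1 / \<zeta> k) = \<zeta> k * poly Q (1 / \<zeta> k)" if "k \<in> {1..Suc m}" for k
      using \<zeta>[OF that] by (simp add: D_def field_simps)
    then have r: "poly P (1 / \<zeta> k) / (\<Prod>j\<in>{1..Suc m}-{k}. 1 - \<zeta> j / \<zeta> k) = \<zeta> k * of_real (t k)"
      if "k \<in> {1..Suc m}" for k
      using residue[OF that] that by (metis times_divide_eq_right)
    have "degree P < card {1..Suc m}"
      using degP by simp
    then have "poly P z = (\<Sum>k=1..Suc m. poly P (1 / \<zeta> k) / (\<Prod>j\<in>{1..Suc m}-{k}. 1 - \<zeta> j / \<zeta> k)
        * (\<Prod>j\<in>{1..Suc m}-{k}. 1 - \<zeta> j * z))"
      using prod_linear_interpolation[OF _ inj, of P z] \<zeta> by blast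
    also have "\<dots> = (\<Sum>k=1..Suc m. \<zeta> k * of_real (t k) * (\<Prod>j\<in>{1..Suc m}-{k}. 1 - \<zeta> j * z))"
      using r by (intro sum.cong refl arg_cong2[of _ _ _ _ "(*)"])
    finally show ?thesis .
  qed
  show thesis
  proof (rule that[OF norm\<zeta> inj])
    show "0 < t k" for k
      using spos by (simp add: t_def)
    \<comment> \<open>At 0 every product in \<open>Qsum\<close> equals 1, and so does
      \<open>Q\<close>.\<close>
    have "of_real (\<Sum>k=1..Suc m. t k) = (1::complex)"
      using Qsum[of 0] pQ[of 0] by simp
    then show "(\<Sum>k=1..Suc m. t k) = 1"
      using of_real_eq_1_iff by blast
    fix z :: complex assume z: "z \<in> \<D>"
    have nz: "1 - \<zeta> k * z \<noteq> 0" if "k \<in> {1..Suc m}" for k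
      using one_minus_ne_nonpos_Reals[OF norm\<zeta>[OF that], of z] z by auto
    have \<phi>PQ: "\<phi> z = poly P z / poly Q z"
      using \<phi>[OF z] by (simp add: pP pQ prod_dividef)
    have Qz: "poly Q z \<noteq> 0"
      using Q0 z by simp
    have "1 - z * \<phi> z = poly D z / poly Q z"
      using Qz by (simp add: \<phi>PQ D_def diff_divide_distrib)
    then have "\<phi> z / (1 - z * \<phi> z) = poly P z / poly D z"
      using Qz by (simp add: \<phi>PQ)
    also have "\<dots> = (\<Sum>k=1..Suc m. \<zeta> k * of_real (t k) *
        ((\<Prod>j\<in>{1..Suc m}-{k}. 1 - \<zeta> j * z) / (\<Prod>j=1..Suc m. 1 - \<zeta> j * z)))"
      unfolding Psum Dprod sum_divide_distrib by simp
    also have "\<dots> = (\<Sum>k=1..Suc m. \<zeta> k * of_real (t k) * (1 / (1 - \<zeta> k * z)))"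
      by (intro sum.cong refl arg_cong2[of _ _ _ _ "(*)"] prod_div_prod_except) (use nz in auto)
    finally show "\<phi> z / (1 - z * \<phi> z) = (\<Sum>k=1..Suc m. of_real (t k) * (\<zeta> k / (1 - \<zeta> k * z)))"
      by (simp add: mult_ac)
  qed
qed

section \<open>From partial fractions back to a Blaschke product\<close>

text \<open>\<open>R\<close> and \<open>M\<close> are the numerators of the sums of
  \<open>t k * \<zeta> k / (1 - \<zeta> k * z)\<close> and of
  \<open>t k / (1 - \<zeta> k * z)\<close> over the common denominator. The \<open>b k\<close> are
  the zeros of \<open>R\<close>; reflection in the circle sends the nonzero ones to zeros of
  \<open>M\<close>, which lie outside the closed disc.\<close>

lemma partial_fractions_eq_Blaschke:
  fixes \<zeta> :: "nat \<Rightarrow> complex" and t :: "nat \<Rightarrow> real" and m :: nat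
  defines "K \<equiv> {1..Suc m}"
  defines "R \<equiv> \<lambda>z. \<Sum>k\<in>K. of_real (t k) * \<zeta> k * (\<Prod>j\<in>K-{k}. 1 - \<zeta> j * z)"
    and "M \<equiv> \<lambda>z. \<Sum>k\<in>K. of_real (t k) * (\<Prod>j\<in>K-{k}. 1 - \<zeta> j * z)"
  assumes \<zeta>: "\<And>k. k \<in> K \<Longrightarrow> norm (\<zeta> k) = 1" and inj: "inj_on \<zeta> K"
    and t: "\<And>k. k \<in> K \<Longrightarrow> 0 < t k" "(\<Sum>k\<in>K. t k) = 1"
  obtains \<gamma> b where "norm \<gamma> = 1" "\<And>k. k \<in> {1..m} \<Longrightarrow> norm (b k) < 1"
    "\<And>z. R z = \<gamma> * (\<Prod>k=1..m. z - b k)" "\<And>z. M z = (\<Prod>k=1..m. 1 - cnj (b k) * z)"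
proof -
  have fin: "finite K"
    by (simp add: K_def)
  have \<zeta>c: "\<zeta> k * cnj (\<zeta> k) = 1" if "k \<in> K" for k
    using \<zeta>[OF that] by (simp add: complex_norm_square[symmetric])
  have \<zeta>0: "\<zeta> k \<noteq> 0" if "k \<in> K" for k
    using \<zeta>[OF that] by auto
  \<comment> \<open>This is the leading coefficient of \<open>R\<close>: the summand for
    \<open>k\<close> contributes \<open>t k * \<gamma>\<close>, and the weights sum to 1.\<close>
  define \<gamma> where "\<gamma> = (-1) ^ m * (\<Prod>k\<in>K. \<zeta> k)"
  have \<gamma>: "norm \<gamma> = 1"
    using \<zeta> by (simp add: \<gamma>_def norm_mult norm_power prod_norm[symmetric])
  have \<gamma>c: "\<gamma> * cnj \<gamma> = 1"
    using \<gamma> by (simp add: complex_norm_square[symmetric])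
  have cardK: "card (K - {k}) = m" if "k \<in> K" for k
    using that by (simp add: K_def)
  have splitK: "(\<Prod>j\<in>K. \<zeta> j) = \<zeta> k * (\<Prod>j\<in>K-{k}. \<zeta> j)" if "k \<in> K" for k
    using prod.remove[OF fin that] .
  define p where "p = (\<Sum>k\<in>K. smult (of_real (t k) * \<zeta> k) (\<Prod>j\<in>K-{k}. [:1, - \<zeta> j:]))"
  have pR: "poly p z = R z" for z
    by (simp add: p_def R_def poly_sum poly_prod mult.commute)
  have degE: "degree (\<Prod>j\<in>K-{k}. [:1, - \<zeta> j:]) = m" if "k \<in> K" for k
    using \<zeta>0 cardK[OF that] by (subst degree_prod_sum_eq) auto
  have "degree p \<le> m"
    unfolding p_def using degE fin by (intro degree_sum_le) (auto intro: order_trans[OF degree_smult_le])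
  have "poly.coeff p m = (\<Sum>k\<in>K. of_real (t k) * \<zeta> k * (\<Prod>j\<in>K-{k}. - \<zeta> j))"
    unfolding p_def coeff_sum
  proof (rule sum.cong)
    fix k assume k: "k \<in> K"
    have "poly.coeff (\<Prod>j\<in>K-{k}. [:1, - \<zeta> j:]) m = lead_coeff (\<Prod>j\<in>K-{k}. [:1, - \<zeta> j:])"
      using degE[OF k] by simp
    also have "\<dots> = (\<Prod>j\<in>K-{k}. - \<zeta> j)"
      unfolding lead_coeff_prod using \<zeta>0 by (intro prod.cong) auto
    finally show "poly.coeff (smult (of_real (t k) * \<zeta> k) (\<Prod>j\<in>K-{k}. [:1, - \<zeta> j:])) m
        = of_real (t k) * \<zeta> k * (\<Prod>j\<in>K-{k}. - \<zeta> j)"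
      by simp
  qed simp
  also have "\<dots> = (\<Sum>k\<in>K. of_real (t k) * \<gamma>)"
  proof (rule sum.cong)
    fix k assume k: "k \<in> K"
    have "(\<Prod>j\<in>K-{k}. - \<zeta> j) = (-1) ^ m * (\<Prod>j\<in>K-{k}. \<zeta> j)"
      using cardK[OF k] by (simp add: prod_uminus)
    then show "of_real (t k) * \<zeta> k * (\<Prod>j\<in>K-{k}. - \<zeta> j) = of_real (t k) * \<gamma>"
      using splitK[OF k] by (simp add: \<gamma>_def mult_ac)
  qed simp
  also have "\<dots> = \<gamma>"
    using t(2) by (simp flip: sum_distrib_right of_real_sum)
  finally have cp: "poly.coeff p m = \<gamma>" .
  then have "degree p = m"
    using \<open>degree p \<le> m\<close> \<gamma> by (metis le_degree le_antisym norm_zero zero_neq_one)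
  obtain r where r: "smult \<gamma> (\<Prod>i<m. [:- r i, 1:]) = p"
    using complex_poly_decompose'[of p] \<open>degree p = m\<close> cp by metis
  \<comment> \<open>Shifts the root indices from \<open>0..m-1\<close> to
    \<open>1..m\<close>.\<close>
  define b where "b k = r (k - 1)" for k
  have Rb: "R z = \<gamma> * (\<Prod>k=1..m. z - b k)" for z
  proof -
    have "R z = \<gamma> * (\<Prod>i<m. z - r i)"
      by (simp add: pR[symmetric] r[symmetric] poly_prod)
    also have "(\<Prod>i<m. z - r i) = (\<Prod>k=1..m. z - b k)"
      by (rule prod.reindex_bij_witness[of _ "\<lambda>k. k - 1" Suc]) (auto simp: b_def)
    finally show ?thesis .
  qed
  \<comment> \<open>\<open>M\<close> is the reciprocal polynomial of \<open>R\<close> up to the factor \<open>\<gamma>\<close>.\<close>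
  have recip: "M z = \<gamma> * (z ^ m * cnj (R (1 / cnj z)))" if z: "z \<noteq> 0" for z
  proof -
    have "\<gamma> * (z ^ m * cnj (R (1 / cnj z)))
        = (\<Sum>k\<in>K. \<gamma> * (z ^ m * (of_real (t k) * cnj (\<zeta> k) * (\<Prod>j\<in>K-{k}. 1 - cnj (\<zeta> j) * (1 / z)))))"
      by (simp add: R_def sum_distrib_left)
    also have "\<dots> = M z"
      unfolding M_def
    proof (rule sum.cong)
      fix k assume k: "k \<in> K"
      have "(\<Prod>j\<in>K-{k}. \<zeta> j) * (z ^ m * (\<Prod>j\<in>K-{k}. 1 - cnj (\<zeta> j) * (1 / z)))
          = (\<Prod>j\<in>K-{k}. \<zeta> j * (z * (1 - cnj (\<zeta> j) * (1 / z))))"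
        using cardK[OF k] by (simp add: prod.distrib)
      \<comment> \<open>Since \<open>\<zeta> j * cnj (\<zeta> j) = 1\<close>, each reflected factor
        is the original one up to sign.\<close>
      also have "\<dots> = (\<Prod>j\<in>K-{k}. (-1) * (1 - \<zeta> j * z))"
        using z \<zeta>c by (intro prod.cong) (auto simp: algebra_simps)
      also have "\<dots> = (-1) ^ m * (\<Prod>j\<in>K-{k}. 1 - \<zeta> j * z)"
        unfolding prod.distrib using cardK[OF k] by simp
      finally have *: "(\<Prod>j\<in>K-{k}. \<zeta> j) * (z ^ m * (\<Prod>j\<in>K-{k}. 1 - cnj (\<zeta> j) * (1 / z)))
          = (-1) ^ m * (\<Prod>j\<in>K-{k}. 1 - \<zeta> j * z)" .
      have "\<gamma> * (z ^ m * (of_real (t k) * cnj (\<zeta> k) * (\<Prod>j\<in>K-{k}. 1 - cnj (\<zeta> j) * (1 / z))))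
          = (-1) ^ m * of_real (t k) * (\<zeta> k * cnj (\<zeta> k))
            * ((\<Prod>j\<in>K-{k}. \<zeta> j) * (z ^ m * (\<Prod>j\<in>K-{k}. 1 - cnj (\<zeta> j) * (1 / z))))"
        by (simp only: \<gamma>_def splitK[OF k] mult_ac)
      also have "\<dots> = ((-1) ^ m * (-1) ^ m) * (of_real (t k) * (\<Prod>j\<in>K-{k}. 1 - \<zeta> j * z))"
        unfolding * \<zeta>c[OF k] by (simp only: mult_ac mult_1)
      also have "(-1) ^ m * (-1) ^ m = (1::complex)"
        by (simp flip: power_mult_distrib)
      finally show "\<gamma> * (z ^ m * (of_real (t k) * cnj (\<zeta> k) * (\<Prod>j\<in>K-{k}. 1 - cnj (\<zeta> j) * (1 / z))))
          = of_real (t k) * (\<Prod>j\<in>K-{k}. 1 - \<zeta> j * z)"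
        by simp
    qed simp
    finally show ?thesis by simp
  qed
  have Mb: "M z = (\<Prod>k=1..m. 1 - cnj (b k) * z)" for z
  \<comment> \<open>The reflection formula \<open>recip\<close> excludes 0, where both sides are
    1.\<close>
  proof (cases "z = 0")
    case True
    then show ?thesis
      using t(2) by (simp add: M_def flip: of_real_sum)
  next
    case False
    have "z ^ m * (\<Prod>k=1..m. 1 / z - cnj (b k)) = (\<Prod>k=1..m. z * (1 / z - cnj (b k)))"
      by (simp add: prod.distrib)
    also have "\<dots> = (\<Prod>k=1..m. 1 - cnj (b k) * z)"
      using False by (intro prod.cong) (auto simp: algebra_simps)
    finally have *: "z ^ m * (\<Prod>k=1..m. 1 / z - cnj (b k)) = (\<Prod>k=1..m. 1 - cnj (b k) * z)" .
    have "M z = (\<gamma> * cnj \<gamma>) * (z ^ m * (\<Prod>k=1..m. 1 / z - cnj (b k)))"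
      by (simp add: recip[OF False] Rb)
    then show ?thesis
      unfolding * \<gamma>c by simp
  qed
  \<comment> \<open>Away from the points \<open>1 / \<zeta> k\<close>, \<open>M z / (\<Prod>k. 1 - \<zeta> k * z)\<close> is a convex combination of
    values of \<open>1 / (1 - u)\<close> with \<open>norm u \<le> 1\<close>, which have positive real part.\<close>
  have M0: "M z \<noteq> 0" if z: "norm z \<le> 1" for z
  proof (cases "\<exists>k\<in>K. \<zeta> k * z = 1")
    \<comment> \<open>At \<open>z = 1 / \<zeta> k\<close> only the summand for \<open>k\<close>
      survives; it is nonzero because \<open>t k > 0\<close> and the \<open>\<zeta> j\<close> are
      distinct.\<close>
    case True
    then obtain k where k: "k \<in> K" "\<zeta> k * z = 1"
      by blast
    have other: "1 - \<zeta> j * z \<noteq> 0" if "j \<in> K - {k}" for j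
    proof
      assume "1 - \<zeta> j * z = 0"
      then have "\<zeta> j * z = \<zeta> k * z" "z \<noteq> 0"
        using k(2) by auto
      then have "\<zeta> j = \<zeta> k"
        by simp
      then show False
        using inj k(1) that by (auto simp: inj_on_def)
    qed
    have zero: "(\<Prod>j\<in>K-{i}. 1 - \<zeta> j * z) = 0" if "i \<in> K - {k}" for i
      using fin k that by (auto intro!: prod_zero bexI[of _ k])
    have "M z = of_real (t k) * (\<Prod>j\<in>K-{k}. 1 - \<zeta> j * z)"
      unfolding M_def using zero by (subst sum.remove[OF fin k(1)]) simp
    then show ?thesis
      using t(1)[OF k(1)] other fin by simp
  next
    case False
    then have nz: "1 - \<zeta> k * z \<noteq> 0" if "k \<in> K" for k
      using that by auto
    have "M z / (\<Prod>j\<in>K. 1 - \<zeta> j * z)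
        = (\<Sum>k\<in>K. of_real (t k) * ((\<Prod>j\<in>K-{k}. 1 - \<zeta> j * z) / (\<Prod>j\<in>K. 1 - \<zeta> j * z)))"
      by (simp add: M_def sum_divide_distrib)
    also have "\<dots> = (\<Sum>k\<in>K. of_real (t k) * (1 / (1 - \<zeta> k * z)))"
      by (intro sum.cong refl arg_cong2[of _ _ _ _ "(*)"] prod_div_prod_except) (use nz fin in auto)
    finally have "Re (M z / (\<Prod>j\<in>K. 1 - \<zeta> j * z)) = (\<Sum>k\<in>K. t k * Re (1 / (1 - \<zeta> k * z)))"
      by (simp only: Re_sum times_complex.sel Re_complex_of_real Im_complex_of_real mult_zero_left diff_zero)
    also have "\<dots> > 0"
    proof (rule sum_pos)
      show "finite K" "K \<noteq> {}"
        by (auto simp: K_def)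
      fix k assume k: "k \<in> K"
      have n: "norm (\<zeta> k * z) \<le> 1"
        using \<zeta>[OF k] z by (simp add: norm_mult)
      \<comment> \<open>A number of modulus at most 1 with real part at least 1 must be 1 itself,
        and that value is excluded in this case.\<close>
      have "Re (1 - \<zeta> k * z) > 0"
      proof (rule ccontr)
        assume "\<not> Re (1 - \<zeta> k * z) > 0"
        then have re: "Re (\<zeta> k * z) = 1"
          using complex_Re_le_cmod[of "\<zeta> k * z"] n by simp
        then have "(Im (\<zeta> k * z))\<^sup>2 \<le> 0"
          using n cmod_power2[of "\<zeta> k * z"] power_le_one[of "norm (\<zeta> k * z)" 2] by simp
        then have "\<zeta> k * z = 1"
          using re by (auto simp: complex_eq_iff)
        then show False
          using nz[OF k] by simp
      qed
      then have "Re (1 / (1 - \<zeta> k * z)) > 0"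
        unfolding Re_divide by (intro divide_pos_pos add_pos_nonneg) auto
      then show "t k * Re (1 / (1 - \<zeta> k * z)) > 0"
        using t(1)[OF k] by simp
    qed
    finally show ?thesis
      by auto
  qed
  show thesis
  proof (rule that[OF \<gamma> _ Rb Mb])
    fix k assume k: "k \<in> {1..m}"
    show "norm (b k) < 1"
    proof (rule ccontr)
      assume ge: "\<not> norm (b k) < 1"
      \<comment> \<open>Otherwise the reflected point \<open>1 / cnj (b k)\<close> would be a zero
        of \<open>M\<close> in the closed disc.\<close>
      then have "cnj (b k) \<noteq> 0"
        by auto
      then have "M (1 / cnj (b k)) = 0"
        unfolding Mb using k by (auto intro!: prod_zero bexI[of _ k])
      moreover have "norm (1 / cnj (b k)) \<le> 1"
        using ge by (simp add: norm_divide divide_le_eq_1)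
      ultimately show False
        using M0 by blast
    qed
  qed
qed

text \<open>With \<open>?N\<close> the common denominator, \<phi>(z) / (1 - z \<phi>(z)) is
  \<open>?R / ?N\<close> and 1 / (1 - z \<phi>(z)) is \<open>?M / ?N\<close>; dividing gives \<phi>
  = \<open>?R / ?M\<close>, whose factors are known.\<close>

lemma partial_fractions_imp_finite_Blaschke_product:
  fixes \<zeta> :: "nat \<Rightarrow> complex" and t :: "nat \<Rightarrow> real" and m :: nat
  assumes "\<phi> \<in> class_B"
    and \<zeta>: "\<And>k. k \<in> {1..Suc m} \<Longrightarrow> norm (\<zeta> k) = 1" and inj: "inj_on \<zeta> {1..Suc m}"
    and t: "\<And>k. k \<in> {1..Suc m} \<Longrightarrow> 0 < t k" "(\<Sum>k=1..Suc m. t k) = 1"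
    and eq: "\<And>z. z \<in> \<D> \<Longrightarrow> \<phi> z / (1 - z * \<phi> z) = (\<Sum>k=1..Suc m. of_real (t k) * (\<zeta> k / (1 - \<zeta> k * z)))"
  shows "finite_Blaschke_product m \<phi>"
proof -
  let ?K = "{1..Suc m}"
  let ?R = "\<lambda>z. \<Sum>k\<in>?K. of_real (t k) * \<zeta> k * (\<Prod>j\<in>?K-{k}. 1 - \<zeta> j * z)"
  let ?M = "\<lambda>z. \<Sum>k\<in>?K. of_real (t k) * (\<Prod>j\<in>?K-{k}. 1 - \<zeta> j * z)"
  let ?N = "\<lambda>z. \<Prod>j\<in>?K. 1 - \<zeta> j * z"
  obtain \<gamma> b where \<gamma>: "norm \<gamma> = 1" and b: "\<And>k. k \<in> {1..m} \<Longrightarrow> norm (b k) < 1"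
    and R: "\<And>z. ?R z = \<gamma> * (\<Prod>k=1..m. z - b k)"
    and M: "\<And>z. ?M z = (\<Prod>k=1..m. 1 - cnj (b k) * z)"
    using partial_fractions_eq_Blaschke[OF \<zeta> inj t] by blast
  have "\<phi> z = \<gamma> * (\<Prod>k=1..m. (z - b k) / (1 - cnj (b k) * z))" if z: "z \<in> \<D>" for z
  proof -
    have nz: "1 - \<zeta> k * z \<noteq> 0" if "k \<in> ?K" for k
      using one_minus_ne_nonpos_Reals[OF \<zeta>[OF that], of z] z by auto
    have N0: "?N z \<noteq> 0"
      using nz by simp
    have div: "(\<Sum>k\<in>?K. c k * (\<Prod>j\<in>?K-{k}. 1 - \<zeta> j * z)) / ?N z = (\<Sum>k\<in>?K. c k * (1 / (1 - \<zeta> k * z)))" for c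
      unfolding sum_divide_distrib times_divide_eq_right[symmetric]
      by (intro sum.cong refl arg_cong2[of _ _ _ _ "(*)"] prod_div_prod_except) (use nz in auto)
    have RN: "\<phi> z / (1 - z * \<phi> z) = ?R z / ?N z"
      unfolding div eq[OF z] by simp
    have "norm (z * \<phi> z) < 1"
    proof -
      have "norm (\<phi> z) \<le> 1"
        using assms(1) z by (auto simp: class_B_def)
      then have "norm z * norm (\<phi> z) \<le> norm z * 1"
        by (intro mult_left_mono) auto
      then show ?thesis
        using z by (simp add: norm_mult)
    qed
    then have ne: "1 - z * \<phi> z \<noteq> 0"
      by auto
    \<comment> \<open>Uses 1 / (1 - u) = 1 + u / (1 - u) with \<open>u = \<zeta> k * z\<close>; the
      weights sum to 1, so the constant terms give 1.\<close>
    have "?M z / ?N z = (\<Sum>k\<in>?K. of_real (t k) + z * (of_real (t k) * (\<zeta> k / (1 - \<zeta> k * z))))"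
      unfolding div using nz by (intro sum.cong refl) (simp add: field_simps)
    also have "\<dots> = of_real (\<Sum>k\<in>?K. t k) + z * (\<Sum>k\<in>?K. of_real (t k) * (\<zeta> k / (1 - \<zeta> k * z)))"
      by (simp only: sum.distrib sum_distrib_left of_real_sum)
    also have "\<dots> = 1 + z * (\<phi> z / (1 - z * \<phi> z))"
      using t(2) eq[OF z] by simp
    also have "\<dots> = 1 / (1 - z * \<phi> z)"
      using ne by (simp add: field_simps)
    finally have MN: "?M z / ?N z = 1 / (1 - z * \<phi> z)" .
    have "\<phi> z * (?M z / ?N z) = ?R z / ?N z"
      unfolding MN RN[symmetric] by simp
    then have "\<phi> z * ?M z = ?R z"
      using N0 by simp
    moreover have "?M z \<noteq> 0"
      using MN ne by auto
    ultimately have "\<phi> z = ?R z / ?M z"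
      by (simp add: eq_divide_eq)
    then show ?thesis
      unfolding R M by (simp add: prod_dividef)
  qed
  then show ?thesis
    unfolding finite_Blaschke_product_def using \<gamma> b by (intro exI[of _ \<gamma>] exI[of _ b]) simp
qed

section \<open>Both directions combined through the partial-fraction identity\<close>

theorem theorem2p3:
  fixes \<alpha> :: real and h \<phi> :: "complex \<Rightarrow> complex" and m :: nat
  assumes "0 < \<alpha>" and "\<alpha> \<le> 1"
    and "h \<in> class_G \<alpha>"
    and "\<phi> \<in> class_B"
    and "\<forall>z\<in>\<D>. deriv (deriv h) z / deriv h z = of_real \<alpha> * (\<phi> z / (z * \<phi> z - 1))"
    and "m \<ge> 1"
  shows "finite_Blaschke_product m \<phi> \<longleftrightarrow>
    (\<exists>(\<zeta> :: nat \<Rightarrow> complex) (t :: nat \<Rightarrow> real).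
       (\<forall>k\<in>{1..m+1}. \<zeta> k \<in> \<T>) \<and> inj_on \<zeta> {1..m+1} \<and>
       (\<forall>k\<in>{1..m+1}. 0 < t k \<and> t k < 1) \<and> (\<Sum>k=1..m+1. t k) = 1 \<and>
       (\<forall>z\<in>\<D>. deriv h z = (\<Prod>k=1..m+1. (1 - \<zeta> k * z) powr of_real (\<alpha> * t k))))"
    (is "_ \<longleftrightarrow> (\<exists>\<zeta> t. ?P \<zeta> t)")
proof
  assume Blaschke: "finite_Blaschke_product m \<phi>"
  show "\<exists>\<zeta> t. ?P \<zeta> t"
  proof (rule finite_Blaschke_product_imp_partial_fractions[OF Blaschke, unfolded Suc_eq_plus1])
    fix \<zeta> :: "nat \<Rightarrow> complex" and t :: "nat \<Rightarrow> real"
    assume \<zeta>: "\<And>k. k \<in> {1..m+1} \<Longrightarrow> norm (\<zeta> k) = 1" "inj_on \<zeta> {1..m+1}"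
      and t: "\<And>k. k \<in> {1..m+1} \<Longrightarrow> 0 < t k" "(\<Sum>k=1..m+1. t k) = 1"
      and eq: "\<And>z. z \<in> \<D> \<Longrightarrow> \<phi> z / (1 - z * \<phi> z) = (\<Sum>k=1..m+1. of_real (t k) * (\<zeta> k / (1 - \<zeta> k * z)))"
    have "t k < 1" if k: "k \<in> {1..m+1}" for k
    proof -
      \<comment> \<open>Some index differs from \<open>k\<close>, since \<open>m \<ge> 1\<close>
        puts both 1 and 2 in the range; its positive weight keeps \<open>t k\<close> below the total
        1.\<close>
      have "(if k = 1 then 2 else 1) \<in> {1..m+1} - {k}"
        using \<open>m \<ge> 1\<close> by auto
      then have "{1..m+1} - {k} \<noteq> {}"
        by blast
      then have "(\<Sum>j\<in>{1..m+1}-{k}. t j) > 0"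
        using t(1) by (intro sum_pos) auto
      then show ?thesis
        using t(2) sum.remove[of "{1..m+1}" k t] k by simp
    qed
    moreover have "\<forall>z\<in>\<D>. deriv h z = (\<Prod>k=1..m+1. (1 - \<zeta> k * z) powr of_real (\<alpha> * t k))"
      using deriv_eq_prod_powr_iff[OF assms(1,3,5), of "{1..m+1}" \<zeta> t] \<zeta>(1) eq by blast
    ultimately have "?P \<zeta> t"
      using \<zeta> t(1) t(2) by (intro conjI ballI) auto
    then show "\<exists>\<zeta> t. ?P \<zeta> t"
      by (intro exI)
  qed
next
  assume "\<exists>\<zeta> t. ?P \<zeta> t"
  then obtain \<zeta> t where P: "?P \<zeta> t"
    by (elim exE) (rule that)
  then have \<zeta>: "norm (\<zeta> k) = 1" if "k \<in> {1..m+1}" for k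
    using that by simp
  have "\<forall>z\<in>\<D>. \<phi> z / (1 - z * \<phi> z) = (\<Sum>k=1..m+1. of_real (t k) * (\<zeta> k / (1 - \<zeta> k * z)))"
    using deriv_eq_prod_powr_iff[OF assms(1,3,5), of "{1..m+1}" \<zeta> t] \<zeta> P by blast
  then show "finite_Blaschke_product m \<phi>"
    using P \<zeta> by (intro partial_fractions_imp_finite_Blaschke_product[OF assms(4), of m \<zeta> t]) auto
qed

end
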